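(* Let $\operatorname{opt}$ be a choice function. Then $\operatorname{back}_{\operatorname{opt}}(T)=\operatorname{norm}_{\operatorname{opt}}(T)$ for every consistent decision tree $T$ if and only if $\operatorname{opt}$ satisfies the backward conditioning property, insensitivity of optimality to the omission of non-optimal elements, preservation of non-optimality under the addition of elements, and the backward mixture property.
   Context: **Gambles.** $\Omega$ is a finite set (the possibility space); subsets of $\Omega$ are events; $\overline{A}=\Omega\setminus A$. $\mathcal{R}$ is an arbitrary set of rewards. A gamble is a function $X\colon\Omega\to\mathcal{R}$. For an event $E$ and a gamble $X$, $EX$ is the restriction of $X$ to $E$, and $\oplus$ combines partial maps with disjoint domains: if $E_1,\dots,E_n$ is a partition of $\Omega$, $\bigoplus_{i=1}^n E_iX_i$ is the gamble that equals $X_i$ on each $E_i$. For sets of gambles, $\bigoplus_{i=1}^n E_i\mathcal{X}_i=\{\bigoplus_{i=1}^n E_iX_i\colon X_i\in\mathcal{X}_i\}$; for an event $A$ and a gamble $Z$, $A\mathcal{X}\oplus\overline{A}Z=\{AX\oplus\overline{A}Z\colon X\in\mathcal{X}\}$. **Choice functions.** A choice function $\operatorname{opt}$ maps every non-empty finite set $\mathcal{X}$ of gambles and every non-empty event $A$ to a set $\operatorname{opt}(\mathcal{X}|A)$ with $\emptyset\neq\operatorname{opt}(\mathcal{X}|A)\subseteq\mathcal{X}$. **Decision trees.** A decision tree is a finite rooted tree whose leaves carry rewards in $\mathcal{R}$ and whose other nodes are decision nodes or chance nodes; the arcs out of a chance node are labelled by events forming a finite partition of $\Omega$. Each tree $T$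 carries an event $\operatorname{ev}(T)$ (the intersection of all events on chance arcs that have preceded $T$). $T=\bigsqcup_{i=1}^n T_i$ means the root of $T$ is a decision node with subtrees $T_i$ at its children; then $\operatorname{ev}(T_i)=\operatorname{ev}(T)$. $T=\bigodot_{i=1}^n E_iT_i$ means the root is a chance node with $T_i$ attached by the arc labelled $E_i$; then $\operatorname{ev}(T_i)=\operatorname{ev}(T)\cap E_i$. For a node $N$ of $T$, $\operatorname{st}_N(T)$ is the subtree of $T$ at $N$, with $\operatorname{ev}(\operatorname{st}_N(T))$ the intersection of $\operatorname{ev}(T)$ with all events on chance arcs on the path from the root of $T$ to $N$. $T$ is consistent if $\operatorname{ev}(\operatorname{st}_N(T))\neq\emptyset$ for every node $N$ of $T$. **Normal form.** A normal form decision of $T$ is a subtree of $T$ (with the same root, and $\operatorname{ev}$ unchanged) obtained by keeping exactly one arc out of each reached decision node and all arcs out of each reached chance node; its nodes are regarded as nodes of $T$. $\operatorname{nfd}(T)$ is the set of all normal form decisions of $T$. $\operatorname{gamb}(T)$ is defined recursively: $\{r\}$ (constant gamble) if $T$ is a leaf with reward $r$; $\operatorname{gamb}(\bigodot_{i} E_iT_i)=\bigoplus_{i} E_i\operatorname{gamb}(T_i)$; $\operatorname{gamb}(\bigsqcup_i T_i)=\bigcup_i\operatorname{gamb}(T_i)$. For a tree $T$ with $\operatorname{ev}(T)\neq\emptyset$, $$\operatorname{norm}_{\operatorname{opt}}(T)=\{U\in\operatorname{nfd}(T)\colon\operatorname{gamb}(U)\subseteq\operatorname{opt}(\operatorname{gamb}(T)|\operatorname{ev}(T))\}.$$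 **Sets of trees.** For sets of trees, $\operatorname{gamb}(\mathcal{T})=\bigcup_{T\in\mathcal{T}}\operatorname{gamb}(T)$, $\operatorname{nfd}(\mathcal{T})=\bigcup_{T\in\mathcal{T}}\operatorname{nfd}(T)$, $\bigodot_i E_i\mathcal{T}_i=\{\bigodot_i E_iT_i\colon T_i\in\mathcal{T}_i\}$, $\bigsqcup_i\mathcal{T}_i=\{\bigsqcup_i T_i\colon T_i\in\mathcal{T}_i\}$. If $\mathcal{T}$ is a set of consistent trees with $\operatorname{ev}(T)=A$ for all $T\in\mathcal{T}$, then $\operatorname{norm}_{\operatorname{opt}}(\mathcal{T})=\{U\in\operatorname{nfd}(\mathcal{T})\colon\operatorname{gamb}(U)\subseteq\operatorname{opt}(\operatorname{gamb}(\mathcal{T})|A)\}$. **Backward induction operator.** For consistent $T$: $\operatorname{back}_{\operatorname{opt}}(T)=\{T\}$ if $T$ is a leaf; $\operatorname{back}_{\operatorname{opt}}(\bigodot_{i=1}^n E_iT_i)=\operatorname{norm}_{\operatorname{opt}}(\bigodot_{i=1}^n E_i\operatorname{back}_{\operatorname{opt}}(T_i))$; $\operatorname{back}_{\operatorname{opt}}(\bigsqcup_{i=1}^n T_i)=\operatorname{norm}_{\operatorname{opt}}(\bigsqcup_{i=1}^n\operatorname{back}_{\operatorname{opt}}(T_i))$. **$A$-consistency.** For a non-empty event $A$, a non-empty finite set $\mathcal{X}$ of gambles is $A$-consistent if for all $r\in\mathcal{R}$ and $X\in\mathcal{X}$ with $X^{-1}(r)\neq\emptyset$ one has $X^{-1}(r)\cap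 A\neq\emptyset$ (equivalently, there is a consistent decision tree $T$ with $\operatorname{ev}(T)=A$ and $\operatorname{gamb}(T)=\mathcal{X}$). A gamble $X$ is $A$-consistent if $\{X\}$ is. **Properties of $\operatorname{opt}$.** - Backward conditioning property: let $A,B$ be events with $A\cap B\neq\emptyset$ and $\overline{A}\cap B\neq\emptyset$, and $\mathcal{X}$ a non-empty finite $A\cap B$-consistent set of gambles with $\{X,Y\}\subseteq\mathcal{X}$ and $AX=AY$. Then $X\in\operatorname{opt}(\mathcal{X}|A\cap B)$ implies $Y\in\operatorname{opt}(\mathcal{X}|A\cap B)$ whenever there is a non-empty finite $\overline{A}\cap B$-consistent set of gambles $\mathcal{Z}$ such that, for at least one $Z\in\mathcal{Z}$, $AX\oplus\overline{A}Z\in\operatorname{opt}(A\mathcal{X}\oplus\overline{A}\mathcal{Z}|B)$. - Insensitivity of optimality to the omission of non-optimal elements: for every event $A\neq\emptyset$ and non-empty finite $A$-consistent sets of gambles $\mathcal{X},\mathcal{Y}$: $\operatorname{opt}(\mathcal{X}|A)\subseteq\mathcal{Y}\subseteq\mathcal{X}$ implies $\operatorname{opt}(\mathcal{Y}|A)=\operatorname{opt}(\mathcal{X}|A)$. - Preservation of non-optimality under the addition of elements: for every event $A\neq\emptyset$ and non-empty finite $A$-consistent sets of gambles $\mathcal{X},\mathcal{Y}$: $\mathcal{Y}\subseteq\mathcal{X}$ implies $\operatorname{opt}(\mathcal{Y}|A)\supseteq\operatorname{opt}(\mathcal{X}|A)\cap\mathcal{Y}$. - Backward mixture property: for all events $A,B$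 with $A\cap B\neq\emptyset$ and $\overline{A}\cap B\neq\emptyset$, every $\overline{A}\cap B$-consistent gamble $Z$ and every non-empty finite $A\cap B$-consistent set of gambles $\mathcal{X}$: $\operatorname{opt}(A\mathcal{X}\oplus\overline{A}Z|B)\subseteq A\operatorname{opt}(\mathcal{X}|A\cap B)\oplus\overline{A}Z$. *)

theory Defs
  imports Main "HOL-Library.Disjoint_Sets"
begin

section \<open>Gambles\<close>

type_synonym ('w, 'r) gamble = "'w \<Rightarrow> 'r"

text \<open>For \<open>[(k\<^sub>1, S\<^sub>1), \<dots>, (k\<^sub>n, S\<^sub>n)]\<close>: all \<open>[(k\<^sub>1, x\<^sub>1), \<dots>, (k\<^sub>n, x\<^sub>n)]\<close> with
  \<open>x\<^sub>i \<in> S\<^sub>i\<close>.  This lifts \<open>\<Oplus>\<close>, \<open>\<Odot>\<close> and \<open>\<Squnion>\<close> to sets of gambles or trees.\<close>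

definition selections :: "('k \<times> 'a set) list \<Rightarrow> ('k \<times> 'a) list set" where
  "selections kSs = {kxs. list_all2 (rel_prod (=) (\<in>)) kxs kSs}"

text \<open>\<open>oplus [(E\<^sub>1, X\<^sub>1), \<dots>, (E\<^sub>n, X\<^sub>n)]\<close> is \<open>E\<^sub>1X\<^sub>1 \<oplus> \<dots> \<oplus> E\<^sub>nX\<^sub>n\<close>; it is only meant to be used when
  the \<open>E\<^sub>i\<close> are pairwise disjoint and cover the possibility space, and then the order of the list
  and the value \<open>undefined\<close> are irrelevant.\<close>

fun oplus :: "('w set \<times> ('w, 'r) gamble) list \<Rightarrow> ('w, 'r) gamble" where
  "oplus [] w = undefined"
| "oplus ((E, X) # EXs) w = (if w \<in> E then X w else oplus EXs w)"

definition oplus_sets :: "('w set \<times> ('w, 'r) gamble set) list \<Rightarrow> ('w, 'r) gamble set" where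
  "oplus_sets EXs = oplus ` selections EXs"


section \<open>Choice functions\<close>

type_synonym ('w, 'r) choice = "('w, 'r) gamble set \<Rightarrow> 'w set \<Rightarrow> ('w, 'r) gamble set"

definition choice_function :: "('w, 'r) choice \<Rightarrow> bool" where
  "choice_function opt \<longleftrightarrow>
     (\<forall>\<X> A. finite \<X> \<and> \<X> \<noteq> {} \<and> A \<noteq> {} \<longrightarrow> opt \<X> A \<noteq> {} \<and> opt \<X> A \<subseteq> \<X>)"


section \<open>Decision trees\<close>

text \<open>The arcs out of a decision node carry natural numbers as names.  They have no meaning of
  their own: they make it possible to regard the nodes of a subtree as nodes of the original tree,
  so that keeping one or the other of two arcs with equal subtrees gives different subtrees.
  Out of a chance node, the events already tell the arcs apart.\<close>

datatype ('w, 'r) dtree =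
    Leaf 'r
  | Decision "(nat \<times> ('w, 'r) dtree) list"
  | Chance "('w set \<times> ('w, 'r) dtree) list"

lemma size_child_less [termination_simp]:
  "(l, t) \<in> set lts \<Longrightarrow> size t < Suc (size_list (size_prod (\<lambda>_. 0) size) lts)"
  by (induction lts) auto

fun decision_tree :: "('w, 'r) dtree \<Rightarrow> bool" where
  "decision_tree (Leaf r) \<longleftrightarrow> True"
| "decision_tree (Decision lts) \<longleftrightarrow>
     lts \<noteq> [] \<and> distinct (map fst lts) \<and> (\<forall>(l, t) \<in> set lts. decision_tree t)"
| "decision_tree (Chance Ets) \<longleftrightarrow>
     distinct (map fst Ets) \<and> partition_on UNIV (fst ` set Ets) \<and>
     (\<forall>(E, t) \<in> set Ets. decision_tree t)"

text \<open>A tree does not store its event, which depends on what precedes it; instead the event is an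
  extra argument \<open>A\<close> of the functions that need it.  \<open>subtrees A T\<close> consists of the pairs of
  \<open>ev(st\<^sub>N(T))\<close> and \<open>st\<^sub>N(T)\<close> for the nodes \<open>N\<close> of \<open>T\<close>, where \<open>ev(T) = A\<close>.\<close>

fun subtrees :: "'w set \<Rightarrow> ('w, 'r) dtree \<Rightarrow> ('w set \<times> ('w, 'r) dtree) set" where
  "subtrees A (Leaf r) = {(A, Leaf r)}"
| "subtrees A (Decision lts) = insert (A, Decision lts) (\<Union>(l, t) \<in> set lts. subtrees A t)"
| "subtrees A (Chance Ets) = insert (A, Chance Ets) (\<Union>(E, t) \<in> set Ets. subtrees (A \<inter> E) t)"

definition consistent :: "'w set \<Rightarrow> ('w, 'r) dtree \<Rightarrow> bool" where
  "consistent A T \<longleftrightarrow> (\<forall>(B, S) \<in> subtrees A T. B \<noteq> {})"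


section \<open>Normal form decisions\<close>

fun nfd :: "('w, 'r) dtree \<Rightarrow> ('w, 'r) dtree set" where
  "nfd (Leaf r) = {Leaf r}"
| "nfd (Decision lts) = (\<Union>(l, t) \<in> set lts. {Decision [(l, U)] | U. U \<in> nfd t})"
| "nfd (Chance Ets) = Chance ` selections (map (\<lambda>(E, t). (E, nfd t)) Ets)"

fun gamb :: "('w, 'r) dtree \<Rightarrow> ('w, 'r) gamble set" where
  "gamb (Leaf r) = {\<lambda>w. r}"
| "gamb (Decision lts) = (\<Union>(l, t) \<in> set lts. gamb t)"
| "gamb (Chance Ets) = oplus_sets (map (\<lambda>(E, t). (E, gamb t)) Ets)"

definition norm_opt :: "('w, 'r) choice \<Rightarrow> 'w set \<Rightarrow> ('w, 'r) dtree \<Rightarrow> ('w, 'r) dtree set" where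
  "norm_opt opt A T = {U \<in> nfd T. gamb U \<subseteq> opt (gamb T) A}"

definition nfd_set :: "('w, 'r) dtree set \<Rightarrow> ('w, 'r) dtree set" where
  "nfd_set \<T> = (\<Union>T \<in> \<T>. nfd T)"

definition gamb_set :: "('w, 'r) dtree set \<Rightarrow> ('w, 'r) gamble set" where
  "gamb_set \<T> = (\<Union>T \<in> \<T>. gamb T)"

definition norm_opt_set ::
  "('w, 'r) choice \<Rightarrow> 'w set \<Rightarrow> ('w, 'r) dtree set \<Rightarrow> ('w, 'r) dtree set" where
  "norm_opt_set opt A \<T> = {U \<in> nfd_set \<T>. gamb U \<subseteq> opt (gamb_set \<T>) A}"


section \<open>Backward induction\<close>

fun back_opt :: "('w, 'r) choice \<Rightarrow> 'w set \<Rightarrow> ('w, 'r) dtree \<Rightarrow> ('w, 'r) dtree set" where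
  "back_opt opt A (Leaf r) = {Leaf r}"
| "back_opt opt A (Decision lts) =
     norm_opt_set opt A (Decision ` selections (map (\<lambda>(l, t). (l, back_opt opt A t)) lts))"
| "back_opt opt A (Chance Ets) =
     norm_opt_set opt A (Chance ` selections (map (\<lambda>(E, t). (E, back_opt opt (A \<inter> E) t)) Ets))"


section \<open>Properties of choice functions\<close>

text \<open>\<open>A\<close>-consistency of a set of gambles.  Non-emptiness of \<open>A\<close> and of the set, and finiteness of
  the set, are part of the notion.\<close>

definition gambles_consistent :: "'w set \<Rightarrow> ('w, 'r) gamble set \<Rightarrow> bool" where
  "gambles_consistent A \<X> \<longleftrightarrow> A \<noteq> {} \<and> finite \<X> \<and> \<X> \<noteq> {} \<and>
     (\<forall>r. \<forall>X \<in> \<X>. X -` {r} \<noteq> {} \<longrightarrow> X -` {r} \<inter> A \<noteq> {})"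

definition backward_conditioning :: "('w, 'r) choice \<Rightarrow> bool" where
  "backward_conditioning opt \<longleftrightarrow>
     (\<forall>A B \<X> X Y. A \<inter> B \<noteq> {} \<and> - A \<inter> B \<noteq> {} \<and> gambles_consistent (A \<inter> B) \<X> \<and>
        {X, Y} \<subseteq> \<X> \<and> (\<forall>w \<in> A. X w = Y w) \<and>
        (\<exists>\<Z>. gambles_consistent (- A \<inter> B) \<Z> \<and>
           (\<exists>Z \<in> \<Z>. oplus [(A, X), (- A, Z)] \<in> opt (oplus_sets [(A, \<X>), (- A, \<Z>)]) B)) \<longrightarrow>
        X \<in> opt \<X> (A \<inter> B) \<longrightarrow> Y \<in> opt \<X> (A \<inter> B))"

definition insensitive_omission :: "('w, 'r) choice \<Rightarrow> bool" where
  "insensitive_omission opt \<longleftrightarrow>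
     (\<forall>A \<X> \<Y>. gambles_consistent A \<X> \<and> gambles_consistent A \<Y> \<and>
        opt \<X> A \<subseteq> \<Y> \<and> \<Y> \<subseteq> \<X> \<longrightarrow> opt \<Y> A = opt \<X> A)"

definition preserves_nonoptimality :: "('w, 'r) choice \<Rightarrow> bool" where
  "preserves_nonoptimality opt \<longleftrightarrow>
     (\<forall>A \<X> \<Y>. gambles_consistent A \<X> \<and> gambles_consistent A \<Y> \<and>
        \<Y> \<subseteq> \<X> \<longrightarrow> opt \<Y> A \<supseteq> opt \<X> A \<inter> \<Y>)"

definition backward_mixture :: "('w, 'r) choice \<Rightarrow> bool" where
  "backward_mixture opt \<longleftrightarrow>
     (\<forall>A B Z \<X>. A \<inter> B \<noteq> {} \<and> - A \<inter> B \<noteq> {} \<and>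
        gambles_consistent (- A \<inter> B) {Z} \<and> gambles_consistent (A \<inter> B) \<X> \<longrightarrow>
        opt (oplus_sets [(A, \<X>), (- A, {Z})]) B
          \<subseteq> oplus_sets [(A, opt \<X> (A \<inter> B)), (- A, {Z})])"

end

theory Submission imports Defs begin

text \<open>At a decision node, backward induction agrees with the normal form solution exactly when
  \<open>opt\<close> is path independent, and path independence splits into preservation of non-optimality and
  insensitivity to omission.  At a chance node, one needs that an optimal \<open>\<Oplus>\<^sub>i E\<^sub>iX\<^sub>i\<close> has every
  \<open>X\<^sub>i\<close> optimal in its subtree.  To see this, fix \<open>i\<close> and write the gamble as \<open>EX \<oplus> (- E)Z\<close>;
  by preservation of non-optimality it stays optimal when \<open>Z\<close> is the only alternative on the
  complement of \<open>E\<close>, so the mixture property yields an optimal \<open>X'\<close> with \<open>EX' = EX\<close>, and the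
  conditioning property transfers optimality from \<open>X'\<close> to \<open>X\<close>.  Insensitivity then shows
  that discarding the non-optimal parts of the subtrees does not change the optimal gambles.
  Conversely, every consistent set of gambles is the gamble set of a consistent tree, and each
  property is read off from a tree with one root node and at most two such subtrees.\<close>

section \<open>Selections\<close>

lemma selections_iff:
  "L \<in> selections (map (\<lambda>(k, x). (k, f x)) xs) \<longleftrightarrow>
     list_all2 (\<lambda>(k, u) (k', x). k = k' \<and> u \<in> f x) L xs"
  by (simp add: selections_def list_all2_map2 rel_prod_sel case_prod_unfold)

lemma set_selections:
  assumes "L \<in> selections (map (\<lambda>(k, x). (k, f x)) xs)" "(k, u) \<in> set L"
  obtains x where "(k, x) \<in> set xs" "u \<in> f x"
  using assms unfolding selections_iff
  by (fastforce simp: list_all2_conv_all_nth in_set_conv_nth)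

lemma selections_Nil [simp]: "selections [] = {[]}"
  by (auto simp: selections_def)

lemma selections_Cons:
  "selections ((k, S) # kSs) = (\<lambda>(x, L). (k, x) # L) ` (S \<times> selections kSs)"
  by (auto simp: selections_def list_all2_Cons2 rel_prod_sel image_iff)

lemma fst_selections: "L \<in> selections kSs \<Longrightarrow> map fst L = map fst kSs"
  unfolding selections_def
  by (simp add: list_all2_conv_all_nth rel_prod_sel list_eq_iff_nth_eq)

lemma finite_selections:
  "(\<And>k S. (k, S) \<in> set kSs \<Longrightarrow> finite S) \<Longrightarrow> finite (selections kSs)"
proof (induction kSs)
  case (Cons p kSs)
  obtain k S where [simp]: "p = (k, S)" by (cases p)
  have "finite S" "finite (selections kSs)" using Cons by auto
  then show ?case by (simp add: selections_Cons)
qed simp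

lemma selections_nonempty:
  "(\<And>k S. (k, S) \<in> set kSs \<Longrightarrow> S \<noteq> {}) \<Longrightarrow> selections kSs \<noteq> {}"
proof (induction kSs)
  case (Cons p kSs)
  obtain k S where [simp]: "p = (k, S)" by (cases p)
  have "S \<noteq> {}" "selections kSs \<noteq> {}" using Cons by auto
  then show ?case by (simp add: selections_Cons)
qed simp

text \<open>Membership in \<open>g\<close> is required only for entries that occur in
  \<open>L\<close>. At a chance node, optimality of a part is known only for the parts of the one
  decision under consideration.\<close>

lemma selections_mono_strong:
  assumes "L \<in> selections (map (\<lambda>(k, x). (k, f k x)) xs)"
    and "\<And>k u x. (k, u) \<in> set L \<Longrightarrow> (k, x) \<in> set xs \<Longrightarrow> u \<in> f k x \<Longrightarrow> u \<in> g k x"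
  shows "L \<in> selections (map (\<lambda>(k, x). (k, g k x)) xs)"
proof -
  have "list_all2 (\<lambda>p q. fst p = fst q \<and> snd p \<in> f (fst q) (snd q)) L xs"
    using assms(1) by (simp add: selections_def list_all2_map2 rel_prod_sel case_prod_unfold)
  then have "list_all2 (\<lambda>p q. fst p = fst q \<and> snd p \<in> g (fst q) (snd q)) L xs"
  proof (rule list.rel_mono_strong)
    fix p q
    assume "p \<in> set L" "q \<in> set xs" "fst p = fst q \<and> snd p \<in> f (fst q) (snd q)"
    then show "fst p = fst q \<and> snd p \<in> g (fst q) (snd q)"
      using assms(2)[of "fst q" "snd p" "snd q"] by (metis prod.collapse)
  qed
  then show ?thesis by (simp add: selections_def list_all2_map2 rel_prod_sel case_prod_unfold)
qed

text \<open>Two successive choices along each key amount to a single choice from the union. This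
  distributes \<open>nfd\<close> and \<open>gamb\<close> over a set of chance trees whose subtrees
  vary independently.\<close>

lemma selections_UN:
  "(\<Union>L \<in> selections kSs. selections (map (\<lambda>(k, x). (k, f x)) L)) =
     selections (map (\<lambda>(k, S). (k, \<Union>x \<in> S. f x)) kSs)"
proof (induction kSs)
  case (Cons p kSs)
  obtain k S where [simp]: "p = (k, S)" by (cases p)
  have "(\<Union>L \<in> selections (p # kSs). selections (map (\<lambda>(k, x). (k, f x)) L)) =
     (\<lambda>(x, L). (k, x) # L) ` ((\<Union>x \<in> S. f x) \<times>
        (\<Union>L \<in> selections kSs. selections (map (\<lambda>(k, x). (k, f x)) L)))"
    by (auto simp: selections_Cons image_iff) blast+
  then show ?case by (simp add: Cons.IH selections_Cons)
qed simp

lemma selections_singletons: "selections (map (\<lambda>(k, x). (k, {x})) L) = {L}"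
  by (induction L) (simp_all add: selections_Cons split_beta)

lemma selections_image:
  "selections (map (\<lambda>(k, S). (k, f ` S)) kSs) =
     map (\<lambda>(k, x). (k, f x)) ` selections kSs"
proof (induction kSs)
  case (Cons p kSs)
  obtain k S where [simp]: "p = (k, S)" by (cases p)
  have "selections (map (\<lambda>(k, S). (k, f ` S)) (p # kSs)) =
      (\<lambda>(x, L). (k, x) # L) ` (f ` S \<times> map (\<lambda>(k, x). (k, f x)) ` selections kSs)"
    by (simp add: selections_Cons Cons.IH)
  also have "\<dots> = map (\<lambda>(k, x). (k, f x)) ` selections (p # kSs)"
    unfolding image_paired_Times[symmetric]
    by (simp add: selections_Cons image_image case_prod_unfold)
  finally show ?case .
qed simp

text \<open>Non-emptiness matters: one empty set would leave no selection at all and so erase the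
  entries at the other keys too. If all sets are non-empty, any chosen entry can be completed to a
  full selection.\<close>

lemma UN_set_selections:
  "(\<And>k S. (k, S) \<in> set kSs \<Longrightarrow> S \<noteq> {}) \<Longrightarrow>
     (\<Union>L \<in> selections kSs. set L) = (\<Union>(k, S) \<in> set kSs. Pair k ` S)"
proof (induction kSs)
  case (Cons p kSs)
  obtain k S where [simp]: "p = (k, S)" by (cases p)
  have ne: "S \<noteq> {}" "selections kSs \<noteq> {}"
    using Cons.prems by (auto intro!: selections_nonempty)
  have "(\<Union>L \<in> selections (p # kSs). set L) = Pair k ` S \<union> (\<Union>L \<in> selections kSs. set L)"
    using ne by (force simp: selections_Cons)
  also have "(\<Union>L \<in> selections kSs. set L) = (\<Union>(k, S) \<in> set kSs. Pair k ` S)"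
    by (rule Cons.IH, rule Cons.prems, erule list.set_intros(2))
  finally show ?case by simp
qed simp


section \<open>Combining gambles\<close>

lemma oplus_eq:
  assumes "(E, X) \<in> set L" "w \<in> E"
    and "\<And>F Y. (F, Y) \<in> set L \<Longrightarrow> w \<in> F \<Longrightarrow> Y w = X w"
  shows "oplus L w = X w"
  using assms by (induction L) fastforce+

text \<open>In a partition each point lies in exactly one event, so the combination is determined
  arc by arc and the order of the list drops out. This criterion replaces the recursion of
  \<open>oplus\<close> in everything that follows about chance nodes.\<close>

lemma oplus_sets_iff:
  assumes d: "distinct (map fst EXs)" and p: "partition_on UNIV (fst ` set EXs)"
  shows "G \<in> oplus_sets EXs \<longleftrightarrow> (\<forall>(E, \<X>) \<in> set EXs. \<exists>X \<in> \<X>. \<forall>w \<in> E. G w = X w)"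
proof
  have unique: "E = F" if "E \<in> fst ` set EXs" "F \<in> fst ` set EXs" "w \<in> E" "w \<in> F" for E F w
    using p that by (fastforce simp: partition_on_def disjoint_def)
  {
    fix L assume L: "L \<in> selections EXs"
    have keys: "map fst L = map fst EXs" by (rule fst_selections[OF L])
    \<comment> \<open>Two entries whose events share \<open>w\<close> have the same event by
      disjointness, and then the same gamble because the keys are distinct. So the first-match rule
      of \<open>oplus\<close> is never ambiguous.\<close>
    have "oplus L w = X w" if "(E, X) \<in> set L" "w \<in> E" for E X w
    proof (rule oplus_eq[OF that])
      fix F Y assume F: "(F, Y) \<in> set L" "w \<in> F"
      have "fst ` set L = fst ` set EXs" by (metis keys list.set_map)
      then have "E = F" using F that unique by (metis fst_conv image_eqI)
      then show "Y w = X w"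
        using F(1) that(1) d keys by (metis eq_key_imp_eq_value)
    qed
  } note agree = this
  {
    assume "G \<in> oplus_sets EXs"
    then obtain L where L: "L \<in> selections EXs" "G = oplus L"
      by (auto simp: oplus_sets_def)
    show "\<forall>(E, \<X>) \<in> set EXs. \<exists>X \<in> \<X>. \<forall>w \<in> E. G w = X w"
    proof clarify
      fix E \<X> assume "(E, \<X>) \<in> set EXs"
      then obtain X where "(E, X) \<in> set L" "X \<in> \<X>"
        using L(1) unfolding selections_def
        by (force simp: list_all2_conv_all_nth in_set_conv_nth rel_prod_sel)
      then show "\<exists>X \<in> \<X>. \<forall>w \<in> E. G w = X w" using agree[OF L(1)] L(2) by blast
    qed
  next
    assume G: "\<forall>(E, \<X>) \<in> set EXs. \<exists>X \<in> \<X>. \<forall>w \<in> E. G w = X w"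
    \<comment> \<open>Each set is cut down to the gambles that match \<open>G\<close> on their
      event; any selection from these recombines to \<open>G\<close>.\<close>
    then have "selections (map (\<lambda>(E, \<X>). (E, {X \<in> \<X>. \<forall>w \<in> E. G w = X w})) EXs) \<noteq> {}"
      by (intro selections_nonempty) fastforce
    then obtain L where
      L: "list_all2 (\<lambda>(E, X) (F, \<X>). E = F \<and> X \<in> \<X> \<and> (\<forall>w \<in> F. G w = X w)) L EXs"
      by (auto simp: selections_def list_all2_map2 rel_prod_sel case_prod_unfold)
    have sel: "L \<in> selections EXs"
      unfolding selections_def using L by (auto elim!: list_all2_mono)
    have "oplus L w = G w" for w
    proof -
      obtain E where E: "E \<in> fst ` set L" "w \<in> E"
        using p fst_selections[OF sel]
        by (metis UNIV_I UnionE list.set_map partition_onD1)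
      then obtain X where X: "(E, X) \<in> set L" by auto
      then have "G w = X w"
        using L E(2) by (fastforce simp: list_all2_conv_all_nth in_set_conv_nth)
      then show ?thesis using agree[OF sel X E(2)] by simp
    qed
    then show "G \<in> oplus_sets EXs" using sel by (auto simp: oplus_sets_def intro!: image_eqI)
  }
qed

lemma oplus_sets_two:
  "oplus_sets [(A, \<X>), (B, \<Y>)] = {oplus [(A, X), (B, Y)] | X Y. X \<in> \<X> \<and> Y \<in> \<Y>}"
  by (force simp: oplus_sets_def selections_Cons)

text \<open>The non-empty preimages are those of the attained values \<open>r = X w\<close>, so the
  condition can be stated pointwise.\<close>

lemma gambles_consistentI:
  assumes "A \<noteq> {}" "finite \<X>" "\<X> \<noteq> {}" "\<And>X w. X \<in> \<X> \<Longrightarrow> \<exists>v \<in> A. X v = X w"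
  shows "gambles_consistent A \<X>"
  unfolding gambles_consistent_def using assms by (fastforce simp: vimage_def)

lemma gambles_consistentD:
  assumes "gambles_consistent A \<X>" "X \<in> \<X>"
  shows "\<exists>v \<in> A. X v = X w"
  using assms unfolding gambles_consistent_def by (fastforce simp: vimage_def)

lemma gambles_consistent_subset:
  "gambles_consistent A \<X> \<Longrightarrow> \<Y> \<subseteq> \<X> \<Longrightarrow> \<Y> \<noteq> {} \<Longrightarrow> gambles_consistent A \<Y>"
  unfolding gambles_consistent_def by (meson finite_subset subsetD)


section \<open>Decision trees and their normal form decisions\<close>

text \<open>The recursion of \<open>nfd\<close> supplies an induction whose hypotheses range over
  the arcs, that is, over pairs in the lists of children.\<close>

lemma dtree_list_induct [case_names Leaf Decision Chance]:
  assumes "\<And>r. P (Leaf r)"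
    and "\<And>lts. (\<And>l t. (l, t) \<in> set lts \<Longrightarrow> P t) \<Longrightarrow> P (Decision lts)"
    and "\<And>Ets. (\<And>E t. (E, t) \<in> set Ets \<Longrightarrow> P t) \<Longrightarrow> P (Chance Ets)"
  shows "P T"
  by (induction T rule: nfd.induct) (use assms in blast)+

lemma consistent_simps [simp]:
  "consistent A (Leaf r) \<longleftrightarrow> A \<noteq> {}"
  "consistent A (Decision lts) \<longleftrightarrow> A \<noteq> {} \<and> (\<forall>(l, t) \<in> set lts. consistent A t)"
  "consistent A (Chance Ets) \<longleftrightarrow> A \<noteq> {} \<and> (\<forall>(E, t) \<in> set Ets. consistent (A \<inter> E) t)"
  by (force simp: consistent_def)+

text \<open>Each decision node of a normal form decision has a single arc, so nothing is left to
  choose. Hence the outer \<open>nfd_set\<close> in backward induction leaves sets of normal form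
  decisions unchanged.\<close>

lemma nfd_nfd: "U \<in> nfd T \<Longrightarrow> nfd U = {U}"
proof (induction T arbitrary: U rule: dtree_list_induct)
  case (Decision lts)
  then show ?case by fastforce
next
  case (Chance Ets)
  from Chance.prems obtain Us where U: "U = Chance Us"
    and sel: "Us \<in> selections (map (\<lambda>(E, t). (E, nfd t)) Ets)"
    by auto
  have "nfd V = {V}" if EV: "(E, V) \<in> set Us" for E V
  proof -
    obtain t where "(E, t) \<in> set Ets" "V \<in> nfd t"
      using set_selections[OF sel EV] .
    then show ?thesis using Chance.IH by blast
  qed
  then have eq: "map (\<lambda>(E, V). (E, nfd V)) Us = map (\<lambda>(E, V). (E, {V})) Us"
    by (auto intro!: map_cong)
  show ?case by (simp add: U eq selections_singletons)
qed simp

lemma decision_tree_nfd: "decision_tree T \<Longrightarrow> U \<in> nfd T \<Longrightarrow> decision_tree U"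
proof (induction T arbitrary: U rule: dtree_list_induct)
  case (Decision lts)
  from Decision.prems(2) obtain l t V
    where V: "(l, t) \<in> set lts" "V \<in> nfd t" "U = Decision [(l, V)]" by auto
  have "decision_tree t" using V(1) Decision.prems(1) by auto
  from Decision.IH[OF V(1) this V(2)] show ?case by (simp add: V(3))
next
  case (Chance Ets)
  from Chance.prems(2) obtain Us where U: "U = Chance Us"
    and sel: "Us \<in> selections (map (\<lambda>(E, t). (E, nfd t)) Ets)"
    by auto
  have keys: "map fst Us = map fst Ets"
    using fst_selections[OF sel] by (simp add: comp_def case_prod_unfold)
  have "fst ` set Us = fst ` set Ets" using arg_cong[OF keys, of set] by simp
  moreover have "decision_tree V" if EV: "(E, V) \<in> set Us" for E V
  proof -
    obtain t where t: "(E, t) \<in> set Ets" "V \<in> nfd t"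
      using set_selections[OF sel EV] .
    have "decision_tree t" using t(1) Chance.prems(1) by auto
    from Chance.IH[OF t(1) this t(2)] show ?thesis .
  qed
  ultimately show ?case
    using Chance.prems(1) unfolding U decision_tree.simps keys by auto
qed simp

text \<open>At a chance node both sides are built from one selection per arc, and taking gambles
  commutes with selecting. The two inclusions are separated in \<open>gamb_of_nfd\<close> and
  \<open>ex_nfd\<close>; they allow passing between decisions and gambles.\<close>

lemma gamb_nfd: "gamb ` nfd T = (\<lambda>X. {X}) ` gamb T"
proof (induction T rule: dtree_list_induct)
  case (Decision lts)
  have "gamb ` nfd (Decision lts) = (\<Union>(l, t) \<in> set lts. gamb ` nfd t)"
    by (simp add: Setcompr_eq_image image_UN image_image case_prod_unfold)
  also have "\<dots> = (\<Union>(l, t) \<in> set lts. (\<lambda>X. {X}) ` gamb t)"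
    using Decision by (intro SUP_cong refl) (metis (no_types, lifting) case_prod_unfold prod.collapse)
  finally show ?case by (simp add: image_UN case_prod_unfold)
next
  case (Chance Ets)
  have cong: "map (\<lambda>(E, t). (E, gamb ` nfd t)) Ets =
      map (\<lambda>(E, t). (E, (\<lambda>X. {X}) ` gamb t)) Ets"
    using Chance by (intro map_cong refl) (metis (no_types, lifting) case_prod_unfold prod.collapse)
  have "gamb ` nfd (Chance Ets) =
      (\<lambda>L. oplus ` selections L) ` map (\<lambda>(E, t). (E, gamb t)) `
        selections (map (\<lambda>(E, t). (E, nfd t)) Ets)"
    by (simp add: image_image oplus_sets_def)
  also have "\<dots> = (\<lambda>L. oplus ` selections L) ` selections (map (\<lambda>(E, t). (E, gamb ` nfd t)) Ets)"
    by (subst selections_image[symmetric]) (simp add: comp_def case_prod_unfold)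
  also have "\<dots> = (\<lambda>L. oplus ` selections L) ` map (\<lambda>(E, X). (E, {X})) `
        selections (map (\<lambda>(E, t). (E, gamb t)) Ets)"
    unfolding cong by (subst selections_image[symmetric]) (simp add: comp_def case_prod_unfold)
  finally show ?case by (simp add: image_image selections_singletons oplus_sets_def)
qed simp

lemma gamb_of_nfd: "U \<in> nfd T \<Longrightarrow> \<exists>X \<in> gamb T. gamb U = {X}"
  using imageI[of U "nfd T" gamb] unfolding gamb_nfd by auto

lemma ex_nfd: "X \<in> gamb T \<Longrightarrow> \<exists>U \<in> nfd T. gamb U = {X}"
  using imageI[of X "gamb T" "\<lambda>X. {X}"] unfolding gamb_nfd[symmetric] by auto

section \<open>Gambles of a chance node, arc by arc\<close>

lemma Chance_arc_unique:
  assumes "decision_tree (Chance Ets)" "(E, t) \<in> set Ets" "(F, s) \<in> set Ets" "w \<in> E" "w \<in> F"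
  shows "E = F \<and> t = s"
proof -
  have "disjoint (fst ` set Ets)" "distinct (map fst Ets)"
    using assms(1) by (auto simp: partition_on_def)
  moreover have "E \<in> fst ` set Ets" "F \<in> fst ` set Ets" using assms(2,3) by force+
  ultimately have "E = F" using assms(4,5) unfolding disjoint_def by blast
  with \<open>distinct (map fst Ets)\<close> show ?thesis
    using assms(2,3) by (auto dest: eq_key_imp_eq_value)
qed

lemma Chance_arc_exists:
  assumes "decision_tree (Chance Ets)"
  obtains E t where "(E, t) \<in> set Ets" "w \<in> E"
proof -
  have "\<Union> (fst ` set Ets) = UNIV" using assms by (simp add: partition_on_def)
  then have "w \<in> \<Union> (fst ` set Ets)" by simp
  then show ?thesis using that by fastforce
qed

lemma gamb_Chance_iff:
  assumes "decision_tree (Chance Ets)"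
  shows "G \<in> gamb (Chance Ets) \<longleftrightarrow> (\<forall>(E, t) \<in> set Ets. \<exists>X \<in> gamb t. \<forall>w \<in> E. G w = X w)"
proof -
  let ?L = "map (\<lambda>(E, t). (E, gamb t)) Ets"
  have keys: "map fst ?L = map fst Ets" "fst ` set ?L = fst ` set Ets"
    by (simp_all add: comp_def case_prod_unfold image_image)
  have "distinct (map fst ?L)" "partition_on UNIV (fst ` set ?L)"
    unfolding keys using assms by simp_all
  from oplus_sets_iff[OF this] show ?thesis by (simp add: case_prod_unfold)
qed

section \<open>Consistent trees and consistent sets of gambles\<close>

lemma gamb_finite_nonempty: "decision_tree T \<Longrightarrow> finite (gamb T) \<and> gamb T \<noteq> {}"
proof (induction T rule: dtree_list_induct)
  case (Decision lts)
  then have "finite (gamb t) \<and> gamb t \<noteq> {}" if "(l, t) \<in> set lts" for l t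
    using that by auto
  moreover obtain l t where "(l, t) \<in> set lts"
    using Decision.prems by (cases lts) auto
  ultimately show ?case by (auto intro!: bexI[of _ "(l, t)"])
next
  case (Chance Ets)
  then have child: "finite (gamb t)" "gamb t \<noteq> {}" if "(E, t) \<in> set Ets" for E t
    using that by auto
  let ?S = "selections (map (\<lambda>(E, t). (E, gamb t)) Ets)"
  have "finite ?S" by (rule finite_selections) (auto dest: child)
  moreover have "?S \<noteq> {}" by (rule selections_nonempty) (auto dest: child)
  ultimately show ?case by (simp add: oplus_sets_def)
qed simp

text \<open>One half of the correspondence between consistent trees and consistent sets. At a chance
  node, a value taken at a point of the arc event \<open>E\<close> is taken by the child's gamble
  somewhere in \<open>A \<inter> E\<close>, where it agrees with the whole gamble.\<close>

lemma gamb_consistent: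
  "decision_tree T \<Longrightarrow> consistent A T \<Longrightarrow> gambles_consistent A (gamb T)"
proof (induction T arbitrary: A rule: dtree_list_induct)
  case (Leaf r)
  then show ?case by (auto intro!: gambles_consistentI)
next
  case (Decision lts)
  show ?case
  proof (rule gambles_consistentI)
    fix X w assume "X \<in> gamb (Decision lts)"
    then obtain l t where lt: "(l, t) \<in> set lts" and X: "X \<in> gamb t" by auto
    have "decision_tree t" "consistent A t" using lt Decision.prems by auto
    from gambles_consistentD[OF Decision.IH[OF lt this] X] show "\<exists>v \<in> A. X v = X w" .
  qed (use Decision.prems gamb_finite_nonempty[OF Decision.prems(1)] in \<open>simp_all del: gamb.simps\<close>)
next
  case (Chance Ets)
  show ?case
  proof (rule gambles_consistentI)
    fix G w assume G: "G \<in> gamb (Chance Ets)"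
    obtain E t where E: "(E, t) \<in> set Ets" "w \<in> E"
      using Chance_arc_exists[OF Chance.prems(1)] .
    then obtain X where X: "X \<in> gamb t" "\<forall>w \<in> E. G w = X w"
      using G gamb_Chance_iff[OF Chance.prems(1)] by blast
    have "decision_tree t" "consistent (A \<inter> E) t" using E(1) Chance.prems by auto
    from gambles_consistentD[OF Chance.IH[OF E(1) this] X(1)] obtain v where "v \<in> A \<inter> E" "X v = X w" by blast
    then show "\<exists>v \<in> A. G v = G w" using X(2) E(2) by (intro bexI[of _ v]) auto
  qed (use Chance.prems gamb_finite_nonempty[OF Chance.prems(1)] in \<open>simp_all del: gamb.simps\<close>)
qed

text \<open>The tree is a chance node whose arcs are the level sets of \<open>X\<close>, each
  leading to a leaf with the corresponding reward. Its consistency says that every level set meets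
  \<open>A\<close>, which is the hypothesis.\<close>

lemma ex_tree_gamble:
  fixes X :: "'w::finite \<Rightarrow> 'r"
  assumes "gambles_consistent A {X}"
  shows "\<exists>T. decision_tree T \<and> consistent A T \<and> gamb T = {X}"
proof -
  obtain rs where rs: "set rs = range X" "distinct rs"
    using finite_distinct_list[of "range X"] by auto
  let ?T = "Chance (map (\<lambda>r. (X -` {r}, Leaf r)) rs)"
  \<comment> \<open>Attained values have distinct level sets, so the arc labels are distinct. The
    restriction to the range matters, since all other level sets are empty.\<close>
  have "inj_on (\<lambda>r. X -` {r}) (range X)"
  proof (rule inj_onI)
    fix r s assume "r \<in> range X" "X -` {r} = X -` {s}"
    then show "r = s" by (metis rangeE vimage_singleton_eq)
  qed
  moreover have "partition_on UNIV ((\<lambda>r. X -` {r}) ` range X)"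
    by (rule partition_onI) (auto simp: disjnt_def)
  ultimately have dt: "decision_tree ?T"
    using rs by (simp add: comp_def distinct_map image_image)
  have "consistent A ?T"
    using assms rs by (auto simp: gambles_consistent_def)
  moreover have "G \<in> gamb ?T \<longleftrightarrow> G = X" for G
    unfolding gamb_Chance_iff[OF dt] using rs by (auto simp: fun_eq_iff)
  ultimately show ?thesis using dt by blast
qed

text \<open>The converse half: a decision node with one child for each gamble of the finite
  set.\<close>

lemma ex_tree:
  fixes \<X> :: "('w::finite, 'r) gamble set"
  assumes "gambles_consistent A \<X>"
  shows "\<exists>T. decision_tree T \<and> consistent A T \<and> gamb T = \<X>"
proof -
  define tree where "tree X = (SOME T. decision_tree T \<and> consistent A T \<and> gamb T = {X})" for X :: "'w \<Rightarrow> 'r"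
  have tree: "decision_tree (tree X) \<and> consistent A (tree X) \<and> gamb (tree X) = {X}"
    if "X \<in> \<X>" for X
  proof -
    have "gambles_consistent A {X}"
      using that by (intro gambles_consistent_subset[OF assms]) simp_all
    from someI_ex[OF ex_tree_gamble[OF this]] show ?thesis unfolding tree_def .
  qed
  have "finite \<X>" using assms by (simp add: gambles_consistent_def)
  from finite_list[OF this] obtain Xs where Xs: "set Xs = \<X>" by (elim exE)
  \<comment> \<open>Numbering the children gives the arcs distinct names, even where subtrees
    coincide.\<close>
  let ?lts = "enumerate 0 (map tree Xs)"
  have snd: "snd ` set ?lts = tree ` \<X>"
    unfolding list.set_map[symmetric] map_snd_enumerate by (simp add: Xs)
  have child: "decision_tree (snd p) \<and> consistent A (snd p)" if p: "p \<in> set ?lts" for p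
  proof -
    obtain X where "X \<in> \<X>" "snd p = tree X"
      using imageI[OF p, of snd] unfolding snd by (elim imageE)
    then show ?thesis by (simp add: tree)
  qed
  have "?lts \<noteq> []"
  proof
    assume "?lts = []"
    with snd have "tree ` \<X> = {}" by (simp only: list.set image_empty)
    with assms show False by (simp add: gambles_consistent_def)
  qed
  then have "decision_tree (Decision ?lts)" "consistent A (Decision ?lts)"
    using child assms by (simp_all add: gambles_consistent_def case_prod_unfold)
  moreover have "gamb (Decision ?lts) = \<Union> (gamb ` snd ` set ?lts)"
    by (simp only: gamb.simps image_image case_prod_unfold)
  then have "gamb (Decision ?lts) = \<X>" unfolding snd using tree by simp
  ultimately show ?thesis by blast
qed


section \<open>Optimal normal form decisions\<close>

lemma choice_functionD:
  assumes "choice_function opt" "gambles_consistent A \<X>"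
  shows "opt \<X> A \<noteq> {}" "opt \<X> A \<subseteq> \<X>"
  using assms by (auto simp: choice_function_def gambles_consistent_def)

text \<open>A normal form decision carries one gamble, so it is kept exactly when that gamble is
  optimal. No optimal gamble is missed, because it lies in \<open>gamb T\<close> and is therefore
  induced by some decision.\<close>

lemma gamb_norm_opt:
  assumes "choice_function opt" "decision_tree T" "consistent A T"
  shows "gamb_set (norm_opt opt A T) = opt (gamb T) A"
proof -
  note opt = choice_functionD(2)[OF assms(1) gamb_consistent[OF assms(2,3)]]
  show ?thesis
  proof
    show "gamb_set (norm_opt opt A T) \<subseteq> opt (gamb T) A"
      by (auto simp: gamb_set_def norm_opt_def)
    show "opt (gamb T) A \<subseteq> gamb_set (norm_opt opt A T)"
    proof
      fix X assume X: "X \<in> opt (gamb T) A"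
      then obtain U where U: "U \<in> nfd T" "gamb U = {X}" using opt ex_nfd[of X T] by blast
      then have "U \<in> norm_opt opt A T" using X by (simp add: norm_opt_def)
      then show "X \<in> gamb_set (norm_opt opt A T)" using U(2) by (force simp: gamb_set_def)
    qed
  qed
qed

lemma norm_opt_nonempty:
  assumes "choice_function opt" "decision_tree T" "consistent A T"
  shows "norm_opt opt A T \<noteq> {}"
  using gamb_norm_opt[OF assms] choice_functionD(1)[OF assms(1) gamb_consistent[OF assms(2,3)]]
  by (auto simp: gamb_set_def)

lemma nfd_norm_opt: "nfd_set (norm_opt opt A T) = norm_opt opt A T"
proof -
  have "(\<Union>U \<in> norm_opt opt A T. nfd U) = (\<Union>U \<in> norm_opt opt A T. {U})"
    by (rule SUP_cong[OF refl]) (auto simp: norm_opt_def dest: nfd_nfd)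
  then show ?thesis by (simp add: nfd_set_def)
qed

text \<open>One step of backward induction once the children agree with the normal form solution.
  The step then depends on the children's gamble sets only through their optimal elements, which
  reduces the comparison with \<open>norm_opt\<close> to statements about
  \<open>opt\<close>.\<close>

lemma back_Decision:
  assumes "choice_function opt" "decision_tree (Decision lts)" "consistent A (Decision lts)"
    and IH: "\<And>l t. (l, t) \<in> set lts \<Longrightarrow> back_opt opt A t = norm_opt opt A t"
  shows "back_opt opt A (Decision lts) =
    {Decision [(l, U)] | l U t. (l, t) \<in> set lts \<and> U \<in> norm_opt opt A t \<and>
       gamb U \<subseteq> opt (\<Union>(l, t) \<in> set lts. opt (gamb t) A) A}"
proof -
  let ?S = "selections (map (\<lambda>(l, t). (l, norm_opt opt A t)) lts)"
  have tree: "decision_tree t" "consistent A t" if "(l, t) \<in> set lts" for l t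
    using that assms(2,3) by auto
  have eq: "map (\<lambda>(l, t). (l, back_opt opt A t)) lts = map (\<lambda>(l, t). (l, norm_opt opt A t)) lts"
    using IH by (intro map_cong refl) (clarsimp simp: case_prod_unfold)
  \<comment> \<open>Every child has an optimal decision, so no arc is lost by forming complete
    selections.\<close>
  have set: "(\<Union>L \<in> ?S. set L) = (\<Union>(l, t) \<in> set lts. Pair l ` norm_opt opt A t)"
    by (subst UN_set_selections) (auto simp: norm_opt_nonempty[OF assms(1) tree])
  \<comment> \<open>A normal form decision keeps one arc of a selection, so only the set of all
    entries occurring in selections matters.\<close>
  have "nfd_set (Decision ` ?S) =
      (\<Union>(l, V) \<in> (\<Union>L \<in> ?S. set L). (\<lambda>U. Decision [(l, U)]) ` nfd V)"
    by (simp add: nfd_set_def Setcompr_eq_image case_prod_unfold)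
  also have "\<dots> = (\<Union>(l, t) \<in> set lts. (\<lambda>U. Decision [(l, U)]) ` nfd_set (norm_opt opt A t))"
    unfolding set
    by (simp add: nfd_set_def case_prod_unfold image_UN image_image
        SUP_UNION[where f = "\<lambda>x. x", simplified])
  finally have nfd: "nfd_set (Decision ` ?S) =
      (\<Union>(l, t) \<in> set lts. (\<lambda>U. Decision [(l, U)]) ` norm_opt opt A t)"
    by (simp only: nfd_norm_opt)
  have "gamb_set (Decision ` ?S) = (\<Union>(l, V) \<in> (\<Union>L \<in> ?S. set L). gamb V)"
    by (simp add: gamb_set_def case_prod_unfold)
  also have "\<dots> = (\<Union>(l, t) \<in> set lts. gamb_set (norm_opt opt A t))"
    unfolding set by (simp add: gamb_set_def case_prod_unfold UN_UN_flatten)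
  also have "\<dots> = (\<Union>(l, t) \<in> set lts. opt (gamb t) A)"
    by (intro SUP_cong refl) (clarsimp simp: gamb_norm_opt[OF assms(1) tree])
  finally have gamb: "gamb_set (Decision ` ?S) = (\<Union>(l, t) \<in> set lts. opt (gamb t) A)" .
  show ?thesis
    unfolding back_opt.simps eq norm_opt_set_def nfd gamb by auto
qed

text \<open>The counterpart at a chance node, where all arcs are kept. Each tree in the set already
  consists of normal form decisions, so \<open>nfd_set\<close> returns the same set.\<close>

lemma back_Chance:
  assumes "choice_function opt" "decision_tree (Chance Ets)" "consistent A (Chance Ets)"
    and IH: "\<And>E t. (E, t) \<in> set Ets \<Longrightarrow> back_opt opt (A \<inter> E) t = norm_opt opt (A \<inter> E) t"
  shows "back_opt opt A (Chance Ets) =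
    {U \<in> Chance ` selections (map (\<lambda>(E, t). (E, norm_opt opt (A \<inter> E) t)) Ets).
       gamb U \<subseteq> opt (oplus_sets (map (\<lambda>(E, t). (E, opt (gamb t) (A \<inter> E))) Ets)) A}"
proof -
  let ?L = "map (\<lambda>(E, t). (E, norm_opt opt (A \<inter> E) t)) Ets"
  have tree: "decision_tree t" "consistent (A \<inter> E) t" if "(E, t) \<in> set Ets" for E t
    using that assms(2,3) by auto
  have eq: "map (\<lambda>(E, t). (E, back_opt opt (A \<inter> E) t)) Ets = ?L"
    using IH by (intro map_cong refl) (clarsimp simp: case_prod_unfold)
  have "nfd_set (Chance ` selections ?L) =
      Chance ` (\<Union>L \<in> selections ?L. selections (map (\<lambda>(E, t). (E, nfd t)) L))"
    by (auto simp: nfd_set_def)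
  also have "\<dots> = Chance ` selections (map (\<lambda>(E, t). (E, nfd_set (norm_opt opt (A \<inter> E) t))) Ets)"
    by (subst selections_UN) (simp add: nfd_set_def comp_def case_prod_unfold)
  finally have nfd: "nfd_set (Chance ` selections ?L) = Chance ` selections ?L"
    by (simp only: nfd_norm_opt)
  have "gamb_set (Chance ` selections ?L) =
      oplus ` (\<Union>L \<in> selections ?L. selections (map (\<lambda>(E, t). (E, gamb t)) L))"
    by (auto simp: gamb_set_def oplus_sets_def)
  also have "\<dots> = oplus_sets (map (\<lambda>(E, t). (E, gamb_set (norm_opt opt (A \<inter> E) t))) Ets)"
    by (subst selections_UN) (simp add: gamb_set_def comp_def case_prod_unfold oplus_sets_def)
  also have "map (\<lambda>(E, t). (E, gamb_set (norm_opt opt (A \<inter> E) t))) Ets =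
      map (\<lambda>(E, t). (E, opt (gamb t) (A \<inter> E))) Ets"
    by (intro map_cong refl) (clarsimp simp: gamb_norm_opt[OF assms(1) tree])
  finally have gamb: "gamb_set (Chance ` selections ?L) =
      oplus_sets (map (\<lambda>(E, t). (E, opt (gamb t) (A \<inter> E))) Ets)" .
  show ?thesis unfolding back_opt.simps eq norm_opt_set_def nfd gamb ..
qed



section \<open>Sufficiency of the four properties\<close>

lemma preserves_nonoptimalityD:
  assumes "preserves_nonoptimality opt" "gambles_consistent A \<X>" "gambles_consistent A \<Y>"
    "\<Y> \<subseteq> \<X>" "X \<in> opt \<X> A" "X \<in> \<Y>"
  shows "X \<in> opt \<Y> A"
  using assms unfolding preserves_nonoptimality_def by (meson IntI subsetD)

lemma insensitive_omissionD:
  assumes "insensitive_omission opt" "gambles_consistent A \<X>" "opt \<X> A \<subseteq> \<Y>" "\<Y> \<subseteq> \<X>"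
    "opt \<X> A \<noteq> {}"
  shows "opt \<Y> A = opt \<X> A"
proof -
  have "gambles_consistent A \<Y>"
    using gambles_consistent_subset[OF assms(2,4)] assms(3,5) by auto
  then show ?thesis using assms(1-4) unfolding insensitive_omission_def by simp
qed

lemma backward_mixtureD:
  assumes "backward_mixture opt" "gambles_consistent (- A \<inter> B) {Z}"
    "gambles_consistent (A \<inter> B) \<X>"
  shows "opt (oplus_sets [(A, \<X>), (- A, {Z})]) B
    \<subseteq> oplus_sets [(A, opt \<X> (A \<inter> B)), (- A, {Z})]"
proof -
  have "A \<inter> B \<noteq> {}" "- A \<inter> B \<noteq> {}" using assms by (simp_all add: gambles_consistent_def)
  then show ?thesis using assms unfolding backward_mixture_def by simp
qed

lemma backward_conditioningD:
  assumes "backward_conditioning opt" "gambles_consistent (A \<inter> B) \<X>"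
    "gambles_consistent (- A \<inter> B) \<Z>" "X \<in> \<X>" "Y \<in> \<X>" "\<forall>w \<in> A. X w = Y w" "Z \<in> \<Z>"
    "oplus [(A, X), (- A, Z)] \<in> opt (oplus_sets [(A, \<X>), (- A, \<Z>)]) B" "X \<in> opt \<X> (A \<inter> B)"
  shows "Y \<in> opt \<X> (A \<inter> B)"
proof -
  have "A \<inter> B \<noteq> {}" "- A \<inter> B \<noteq> {}" using assms by (simp_all add: gambles_consistent_def)
  moreover have "{X, Y} \<subseteq> \<X>" using assms by simp
  ultimately show ?thesis
    using assms(2,3,6-9)
    by (intro assms(1)[unfolded backward_conditioning_def, rule_format, of A B \<X> X Y]) blast+
qed

text \<open>The remaining arcs out of the chance node are merged into one gamble on the complement of
  \<open>E\<close>.  Its values on \<open>E\<close> are irrelevant, but they must be attained outside \<open>E\<close> for it to be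
  consistent: it is constant there.\<close>

lemma optimal_on_arc:
  assumes opt: "choice_function opt"
    and bc: "backward_conditioning opt" and pn: "preserves_nonoptimality opt"
    and bm: "backward_mixture opt"
    and T: "decision_tree (Chance Ets)" "consistent A (Chance Ets)"
    and G: "G \<in> opt (gamb (Chance Ets)) A"
    and E: "(E, t) \<in> set Ets" and X: "X \<in> gamb t" and GX: "\<forall>w \<in> E. G w = X w"
  shows "X \<in> opt (gamb t) (A \<inter> E)"
proof -
  let ?G = "gamb (Chance Ets)"
  have tree: "decision_tree s" "consistent (A \<inter> F) s" if "(F, s) \<in> set Ets" for F s
    using that T by auto
  note arcs = gamb_Chance_iff[OF T(1)]
  have Gcons: "gambles_consistent A ?G" by (rule gamb_consistent[OF T])
  have XC: "gambles_consistent (E \<inter> A) (gamb t)"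
    using gamb_consistent[OF tree[OF E]] by (simp only: Int_commute)
  have G_in: "G \<in> ?G" using G choice_functionD(2)[OF opt Gcons] by blast
  have off: "w \<notin> E" if "(F, s) \<in> set Ets" "(F, s) \<noteq> (E, t)" "w \<in> F" for F s w
    using Chance_arc_unique[OF T(1) that(1) E that(3)] that(2) by blast
  show ?thesis
  proof (cases "\<exists>w1. w1 \<in> - E \<inter> A")
    case False
    \<comment> \<open>Here \<open>A\<close> lies inside \<open>E\<close>, so the conditioning and
      mixture properties cannot be applied. But consistency makes every arc event meet
      \<open>A\<close>, hence this arc is the only one and the node has the gambles of
      \<open>t\<close>.\<close>
    then have "A \<inter> E = A" by blast
    have only: "(F, s) = (E, t)" if "(F, s) \<in> set Ets" for F s
    proof (rule ccontr)
      assume neq: "(F, s) \<noteq> (E, t)"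
      have "A \<inter> F \<noteq> {}"
        using gamb_consistent[OF tree[OF that]] by (simp add: gambles_consistent_def)
      then show False using off[OF that neq] False by blast
    qed
    have "w \<in> E" for w
    proof -
      obtain F s where F: "(F, s) \<in> set Ets" "w \<in> F" using Chance_arc_exists[OF T(1)] .
      then show ?thesis using only[OF F(1)] by simp
    qed
    then have "E = UNIV" by blast
    then have "G = X" using GX by (simp add: fun_eq_iff)
    have "p = (E, t)" if "p \<in> set Ets" for p using only[of "fst p" "snd p"] that by simp
    then have "set Ets = {(E, t)}" using E by blast
    then have "K \<in> ?G \<longleftrightarrow> K \<in> gamb t" for K
      unfolding arcs using \<open>E = UNIV\<close> by (simp add: fun_eq_iff[symmetric])
    then have "?G = gamb t" by (rule set_eqI)
    then show ?thesis using G \<open>G = X\<close> \<open>A \<inter> E = A\<close> by simp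
  next
    case True
    then obtain w1 where w1: "w1 \<in> - E \<inter> A" by blast
    define h where "h G' = (\<lambda>w. if w \<in> E then G' w1 else G' w)" for G' :: "'a \<Rightarrow> 'b"
    let ?Z = "h ` ?G"
    \<comment> \<open>Recombination stays in \<open>?G\<close> because membership is tested arc by
      arc: \<open>Y\<close> serves on \<open>E\<close>, and the components of \<open>K'\<close>
      serve on the other arcs.\<close>
    have merge: "oplus_sets [(E, gamb t), (- E, ?Z)] = ?G"
    proof (intro set_eqI iffI)
      fix K assume "K \<in> oplus_sets [(E, gamb t), (- E, ?Z)]"
      then obtain Y K' where Y: "Y \<in> gamb t" and K': "K' \<in> ?G"
        and K: "K = oplus [(E, Y), (- E, h K')]"
        unfolding oplus_sets_two by blast
      have "\<exists>Y' \<in> gamb s. \<forall>w \<in> F. K w = Y' w" if F: "(F, s) \<in> set Ets" for F s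
      proof (cases "(F, s) = (E, t)")
        case True
        then show ?thesis using Y by (auto simp: K)
      next
        case False
        obtain Y' where "Y' \<in> gamb s" "\<forall>w \<in> F. K' w = Y' w"
          using K' F unfolding arcs by blast
        then show ?thesis using off[OF F False] by (intro bexI[of _ Y']) (auto simp: K h_def)
      qed
      then show "K \<in> ?G" unfolding arcs by blast
    next
      fix K assume K: "K \<in> ?G"
      then obtain Y where Y: "Y \<in> gamb t" "\<forall>w \<in> E. K w = Y w" using E unfolding arcs by blast
      have "K = oplus [(E, Y), (- E, h K)]" using Y(2) by (simp add: fun_eq_iff h_def)
      then show "K \<in> oplus_sets [(E, gamb t), (- E, ?Z)]"
        unfolding oplus_sets_two using Y(1) K by blast
    qed
    have ZC: "gambles_consistent (- E \<inter> A) ?Z"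
    proof (rule gambles_consistentI)
      fix Z w assume "Z \<in> ?Z"
      then obtain K where K: "K \<in> ?G" and Z: "Z = h K" by blast
      \<comment> \<open>The point outside \<open>E\<close> from which \<open>h K\<close> takes its
        value at \<open>w\<close>. Consistency of the child on the arc through \<open>u\<close> then
        yields a point of \<open>A\<close> outside \<open>E\<close> with this value.\<close>
      define u where "u = (if w \<in> E then w1 else w)"
      have u: "u \<notin> E" "Z w = K u" using w1 by (auto simp: u_def Z h_def)
      obtain F s where F: "(F, s) \<in> set Ets" "u \<in> F" using Chance_arc_exists[OF T(1)] .
      have neq: "(F, s) \<noteq> (E, t)" using F(2) u(1) by blast
      obtain Y where Y: "Y \<in> gamb s" "\<forall>w \<in> F. K w = Y w"
        using K F(1) unfolding arcs by blast
      obtain v where v: "v \<in> A \<inter> F" "Y v = Y u"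
        using gambles_consistentD[OF gamb_consistent[OF tree[OF F(1)]] Y(1)] by blast
      have "v \<notin> E" using off[OF F(1) neq] v(1) by blast
      moreover have "Z v = Z w" using \<open>v \<notin> E\<close> u(2) v Y(2) F(2) by (simp add: Z h_def)
      ultimately show "\<exists>v \<in> - E \<inter> A. Z v = Z w" using v(1) by blast
    qed (use w1 Gcons in \<open>auto simp: gambles_consistent_def simp del: gamb.simps oplus.simps\<close>)
    \<comment> \<open>The smaller problem in which only the choice on \<open>E\<close> remains open,
      as the mixture property requires.\<close>
    let ?Y = "oplus_sets [(E, gamb t), (- E, {h G})]"
    have G_eq: "G = oplus [(E, X), (- E, h G)]"
      using GX by (simp add: fun_eq_iff h_def)
    have G_Y: "G \<in> ?Y" 
      unfolding oplus_sets_two by (intro CollectI exI conjI, rule G_eq, rule X, simp)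
    have "?Y \<subseteq> oplus_sets [(E, gamb t), (- E, ?Z)]"
      unfolding oplus_sets_two using G_in by blast
    then have Y_sub: "?Y \<subseteq> ?G" unfolding merge .
    have YC: "gambles_consistent A ?Y"
      by (rule gambles_consistent_subset[OF Gcons Y_sub]) (use G_Y in blast)
    have "G \<in> opt ?Y A"
      by (rule preserves_nonoptimalityD[OF pn Gcons YC Y_sub G G_Y])
    moreover have "gambles_consistent (- E \<inter> A) {h G}"
      by (rule gambles_consistent_subset[OF ZC]) (use G_in in simp_all)
    then have "opt ?Y A \<subseteq> oplus_sets [(E, opt (gamb t) (E \<inter> A)), (- E, {h G})]"
      by (rule backward_mixtureD[OF bm _ XC])
    \<comment> \<open>Only values on \<open>E\<close> are compared, so \<open>X'\<close> may differ
      from \<open>X\<close> elsewhere; the conditioning property bridges this gap.\<close>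
    ultimately obtain X' where X': "X' \<in> opt (gamb t) (E \<inter> A)"
      and G_eq': "G = oplus [(E, X'), (- E, h G)]"
      unfolding oplus_sets_two by blast
    have "G w = X' w" if "w \<in> E" for w using fun_cong[OF G_eq', of w] that by simp
    then have agree: "\<forall>w \<in> E. X' w = X w" using GX by simp
    have "X' \<in> gamb t" using X' choice_functionD(2)[OF opt XC] by blast
    moreover have "oplus [(E, X'), (- E, h G)] \<in> opt (oplus_sets [(E, gamb t), (- E, ?Z)]) A"
      using G by (simp only: merge G_eq'[symmetric])
    ultimately have "X \<in> opt (gamb t) (E \<inter> A)"
      by (intro backward_conditioningD[OF bc XC ZC _ X agree imageI[OF G_in]] X')
    then show ?thesis by (simp only: Int_commute)
  qed
qed

lemma back_opt_eq_norm_opt: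
  assumes opt: "choice_function opt"
    and bc: "backward_conditioning opt" and io: "insensitive_omission opt"
    and pn: "preserves_nonoptimality opt" and bm: "backward_mixture opt"
  shows "decision_tree T \<Longrightarrow> consistent A T \<Longrightarrow> back_opt opt A T = norm_opt opt A T"
proof (induction T arbitrary: A rule: dtree_list_induct)
  case (Leaf r)
  note opt_Leaf = choice_functionD[OF opt gamb_consistent[OF Leaf]]
  from subset_singletonD[OF opt_Leaf(2)[unfolded gamb.simps]] opt_Leaf(1)
  have "opt {\<lambda>w. r} A = {\<lambda>w. r}" by simp
  then show ?case by (simp add: norm_opt_def cong: conj_cong)
next
  case (Decision lts)
  let ?X = "gamb (Decision lts)" and ?Y = "\<Union>(l, t) \<in> set lts. opt (gamb t) A"
  have tree: "decision_tree t" "consistent A t" if "(l, t) \<in> set lts" for l t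
    using that Decision.prems by auto
  have XC: "gambles_consistent A ?X" by (rule gamb_consistent[OF Decision.prems])
  note optX = choice_functionD[OF opt XC]
  \<comment> \<open>Named after Sen's property alpha for choice from a submenu, here the gambles of
    one child.\<close>
  have alpha: "X \<in> opt (gamb t) A" if "(l, t) \<in> set lts" "X \<in> gamb t" "X \<in> opt ?X A" for l t X
  proof -
    have "gamb t \<subseteq> ?X" using that(1) by auto
    then show ?thesis
      by (rule preserves_nonoptimalityD[OF pn XC gamb_consistent[OF tree[OF that(1)]] _ that(3,2)])
  qed
  \<comment> \<open>This and the next inclusion place \<open>?Y\<close> between the optimal gambles
    and \<open>?X\<close>, as insensitivity to omission asks.\<close>
  have sub: "opt ?X A \<subseteq> ?Y"
  proof
    fix X assume X: "X \<in> opt ?X A"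
    have "X \<in> ?X" using optX(2) X by (rule subsetD)
    then obtain l t where lt: "(l, t) \<in> set lts" "X \<in> gamb t" by auto
    from lt(1) alpha[OF lt X] show "X \<in> ?Y" by auto
  qed
  have "?Y \<subseteq> ?X"
  proof
    fix X assume "X \<in> ?Y"
    then obtain l t where lt: "(l, t) \<in> set lts" "X \<in> opt (gamb t) A" by auto
    have "X \<in> gamb t"
      using choice_functionD(2)[OF opt gamb_consistent[OF tree[OF lt(1)]]] lt(2) by (rule subsetD)
    then show "X \<in> ?X" using lt(1) by auto
  qed
  from insensitive_omissionD[OF io XC sub this optX(1)] have eq: "opt ?Y A = opt ?X A" .
  have back_eq: "back_opt opt A (Decision lts) =
    {Decision [(l, U)] | l U t. (l, t) \<in> set lts \<and> U \<in> norm_opt opt A t \<and> gamb U \<subseteq> opt ?X A}"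
    unfolding eq[symmetric]
    by (rule back_Decision[OF opt Decision.prems]) (rule Decision.IH, assumption, erule tree, erule tree)
  show ?case
  proof (intro set_eqI iffI)
    fix U assume "U \<in> back_opt opt A (Decision lts)"
    then show "U \<in> norm_opt opt A (Decision lts)" unfolding back_eq by (auto simp: norm_opt_def)
  next
    fix U assume U: "U \<in> norm_opt opt A (Decision lts)"
    then obtain l t V where V: "(l, t) \<in> set lts" "V \<in> nfd t" "U = Decision [(l, V)]"
      by (auto simp: norm_opt_def)
    obtain X where X: "X \<in> gamb t" "gamb V = {X}" using gamb_of_nfd[OF V(2)] by blast
    have opt_V: "gamb V \<subseteq> opt ?X A" using U V(3) by (simp add: norm_opt_def)
    then have "V \<in> norm_opt opt A t" using alpha[OF V(1) X(1)] X(2) V(2) by (simp add: norm_opt_def)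
    then show "U \<in> back_opt opt A (Decision lts)" unfolding back_eq using V opt_V by blast
  qed
next
  case (Chance Ets)
  let ?X = "gamb (Chance Ets)"
  let ?L = "map (\<lambda>(E, t). (E, opt (gamb t) (A \<inter> E))) Ets"
  let ?Y = "oplus_sets ?L"
  note arcs = gamb_Chance_iff[OF Chance.prems(1)]
  note on_arc = optimal_on_arc[OF opt bc pn bm Chance.prems]
  have tree: "decision_tree t" "consistent (A \<inter> E) t" if "(E, t) \<in> set Ets" for E t
    using that Chance.prems by auto
  have XC: "gambles_consistent A ?X" by (rule gamb_consistent[OF Chance.prems])
  note optX = choice_functionD[OF opt XC]
  have keys: "map fst ?L = map fst Ets" "fst ` set ?L = fst ` set Ets"
    by (simp_all add: comp_def case_prod_unfold image_image)
  have "distinct (map fst ?L)" "partition_on UNIV (fst ` set ?L)"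
    unfolding keys using Chance.prems(1) by simp_all
  from oplus_sets_iff[OF this]
  have Y_iff: "G \<in> ?Y \<longleftrightarrow> (\<forall>(E, t) \<in> set Ets. \<exists>X \<in> opt (gamb t) (A \<inter> E). \<forall>w \<in> E. G w = X w)" for G
    by (simp add: case_prod_unfold)
  have sub: "opt ?X A \<subseteq> ?Y"
  proof
    fix G assume G: "G \<in> opt ?X A"
    have "\<exists>X \<in> opt (gamb t) (A \<inter> E). \<forall>w \<in> E. G w = X w" if E: "(E, t) \<in> set Ets" for E t
    proof -
      obtain X where "X \<in> gamb t" "\<forall>w \<in> E. G w = X w" using G E optX(2) unfolding arcs subset_iff by blast
      then show ?thesis using on_arc[OF G E] by blast
    qed
    then show "G \<in> ?Y" unfolding Y_iff by blast
  qed
  have "?Y \<subseteq> ?X"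
  proof
    fix G assume G: "G \<in> ?Y"
    have "\<exists>X \<in> gamb t. \<forall>w \<in> E. G w = X w" if E: "(E, t) \<in> set Ets" for E t
    proof -
      obtain X where "X \<in> opt (gamb t) (A \<inter> E)" "\<forall>w \<in> E. G w = X w" using G E unfolding Y_iff by blast
      then show ?thesis using choice_functionD(2)[OF opt gamb_consistent[OF tree[OF E]]] by blast
    qed
    then show "G \<in> ?X" unfolding arcs by blast
  qed
  from insensitive_omissionD[OF io XC sub this optX(1)] have eq: "opt ?Y A = opt ?X A" .
  have back_eq: "back_opt opt A (Chance Ets) =
    {U \<in> Chance ` selections (map (\<lambda>(E, t). (E, norm_opt opt (A \<inter> E) t)) Ets). gamb U \<subseteq> opt ?X A}"
    unfolding eq[symmetric]
    by (rule back_Chance[OF opt Chance.prems]) (rule Chance.IH, assumption, erule tree, erule tree)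
  show ?case
  proof (intro set_eqI iffI)
    fix U assume "U \<in> back_opt opt A (Chance Ets)"
    then obtain Us where Us: "U = Chance Us" "gamb U \<subseteq> opt ?X A"
      and sel: "Us \<in> selections (map (\<lambda>(E, t). (E, norm_opt opt (A \<inter> E) t)) Ets)"
      unfolding back_eq by blast
    have "Us \<in> selections (map (\<lambda>(E, t). (E, nfd t)) Ets)"
      by (rule selections_mono_strong[OF sel]) (simp add: norm_opt_def)
    then show "U \<in> norm_opt opt A (Chance Ets)"
      using Us unfolding norm_opt_def nfd.simps by blast
  next
    fix U assume U: "U \<in> norm_opt opt A (Chance Ets)"
    then have U_nfd: "U \<in> nfd (Chance Ets)" and opt_U: "gamb U \<subseteq> opt ?X A"
      by (simp_all add: norm_opt_def del: nfd.simps gamb.simps)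
    from U_nfd obtain Us where Us: "U = Chance Us"
      and sel: "Us \<in> selections (map (\<lambda>(E, t). (E, nfd t)) Ets)"
      by auto
    obtain G where G: "gamb (Chance Us) = {G}" using gamb_of_nfd[OF U_nfd] Us by blast
    have G_opt: "G \<in> opt ?X A" using opt_U Us G by blast
    \<comment> \<open>The decision is itself a decision tree, so the arc criterion applies to it: on
      each arc \<open>G\<close> agrees with the single gamble of the part kept there.\<close>
    have "G \<in> gamb (Chance Us)" using G by blast
    moreover have "decision_tree (Chance Us)" using decision_tree_nfd[OF Chance.prems(1) U_nfd] Us by simp
    ultimately have G_arc: "\<exists>X \<in> gamb V. \<forall>w \<in> E. G w = X w" if "(E, V) \<in> set Us" for E V
      using gamb_Chance_iff that by blast
    have "Us \<in> selections (map (\<lambda>(E, t). (E, norm_opt opt (A \<inter> E) t)) Ets)"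
    proof (rule selections_mono_strong[OF sel])
      fix E V t assume EV: "(E, V) \<in> set Us" and E: "(E, t) \<in> set Ets" and V: "V \<in> nfd t"
      obtain X where X: "X \<in> gamb t" "gamb V = {X}" using gamb_of_nfd[OF V] by blast
      have "\<forall>w \<in> E. G w = X w" using G_arc[OF EV] X(2) by simp
      then have "X \<in> opt (gamb t) (A \<inter> E)" by (rule on_arc[OF G_opt E X(1)])
      then show "V \<in> norm_opt opt (A \<inter> E) t" using V X(2) by (simp add: norm_opt_def)
    qed
    then show "U \<in> back_opt opt A (Chance Ets)" unfolding back_eq Us using opt_U Us by blast
  qed
qed


section \<open>Necessity of the four properties\<close>

context
  fixes opt :: "('w, 'r) choice"
  assumes opt: "choice_function opt"
    and back_norm_all:
      "\<forall>A T. decision_tree T \<and> consistent A T \<longrightarrow> back_opt opt A T = norm_opt opt A T"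
begin

lemma back_norm: "decision_tree T \<Longrightarrow> consistent A T \<Longrightarrow> back_opt opt A T = norm_opt opt A T"
  using back_norm_all by simp

text \<open>Agreement is used at the node and at all its children, so that \<open>norm_opt\<close>
  inherits the recursion of \<open>back_opt\<close>.\<close>

lemma norm_Decision:
  assumes T: "decision_tree (Decision lts)" "consistent A (Decision lts)"
  shows "norm_opt opt A (Decision lts) =
    {Decision [(l, U)] | l U t. (l, t) \<in> set lts \<and> U \<in> norm_opt opt A t \<and>
       gamb U \<subseteq> opt (\<Union>(l, t) \<in> set lts. opt (gamb t) A) A}"
  unfolding back_norm[OF T, symmetric]
  by (rule back_Decision[OF opt T], rule back_norm) (use T in auto)

text \<open>Take the decision that follows arc \<open>l\<close> and then induces \<open>X\<close>.
  It solves the whole tree, and by the recursion its part below \<open>l\<close> solves the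
  child.\<close>

lemma optimal_at_Decision_child:
  assumes T: "decision_tree (Decision lts)" "consistent A (Decision lts)"
    and lt: "(l, t) \<in> set lts" and X: "X \<in> gamb t" "X \<in> opt (gamb (Decision lts)) A"
  shows "X \<in> opt (gamb t) A"
proof -
  obtain U where U: "U \<in> nfd t" "gamb U = {X}" using ex_nfd[OF X(1)] by blast
  then have "Decision [(l, U)] \<in> norm_opt opt A (Decision lts)"
    using lt X(2) by (auto simp: norm_opt_def)
  then obtain t' where t': "(l, t') \<in> set lts" "U \<in> norm_opt opt A t'"
    unfolding norm_Decision[OF T] by blast
  \<comment> \<open>The arc name identifies the child, so the part cannot be credited to another
    subtree that contains the same decision.\<close>
  have "t' = t" using T(1) t'(1) lt by (auto dest: eq_key_imp_eq_value)
  then show ?thesis using t'(2) U(2) by (simp add: norm_opt_def)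
qed

text \<open>Plott's path independence of \<open>opt\<close> along the arcs of the node. Both
  inclusions compare the gambles of the decisions described by the two forms of
  \<open>norm_opt\<close>.\<close>

lemma optimal_Decision:
  assumes T: "decision_tree (Decision lts)" "consistent A (Decision lts)"
  shows "opt (gamb (Decision lts)) A = opt (\<Union>(l, t) \<in> set lts. opt (gamb t) A) A"
    (is "opt ?X A = opt ?Y A")
proof
  have tree: "decision_tree t" "consistent A t" if "(l, t) \<in> set lts" for l t
    using that T by auto
  have XC: "gambles_consistent A ?X" by (rule gamb_consistent[OF T])
  have child: "opt (gamb t) A \<subseteq> gamb t" if "(l, t) \<in> set lts" for l t
    by (rule choice_functionD(2)[OF opt gamb_consistent[OF tree[OF that]]])
  show "opt ?X A \<subseteq> opt ?Y A"
  proof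
    fix X assume X: "X \<in> opt ?X A"
    then have "X \<in> ?X" using choice_functionD(2)[OF opt XC] by blast
    then obtain U where U: "U \<in> nfd (Decision lts)" "gamb U = {X}"
      using ex_nfd by blast
    then have "U \<in> norm_opt opt A (Decision lts)"
      using X by (simp add: norm_opt_def del: nfd.simps gamb.simps)
    then have "gamb U \<subseteq> opt ?Y A" unfolding norm_Decision[OF T] by auto
    then show "X \<in> opt ?Y A" using U(2) by simp
  qed
  have "gambles_consistent A ?Y"
  proof (rule gambles_consistent_subset[OF XC])
    show "?Y \<subseteq> ?X" using child by auto
    obtain l t where lt: "(l, t) \<in> set lts" using T(1) by (cases lts) auto
    have "opt (gamb t) A \<noteq> {}"
      by (rule choice_functionD(1)[OF opt gamb_consistent[OF tree[OF lt]]])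
    then show "?Y \<noteq> {}" using lt by auto
  qed
  note optY = choice_functionD(2)[OF opt this]
  show "opt ?Y A \<subseteq> opt ?X A"
  proof
    fix X assume X: "X \<in> opt ?Y A"
    then obtain l t where lt: "(l, t) \<in> set lts" and Xt: "X \<in> opt (gamb t) A" using optY by auto
    obtain U where U: "U \<in> nfd t" "gamb U = {X}" using ex_nfd child[OF lt] Xt by blast
    then have "U \<in> norm_opt opt A t" using Xt by (simp add: norm_opt_def)
    then have "Decision [(l, U)] \<in> norm_opt opt A (Decision lts)"
      unfolding norm_Decision[OF T] using lt X U(2)
      by (intro CollectI exI[of _ l] exI[of _ U] exI[of _ t]) simp
    then have "gamb (Decision [(l, U)]) \<subseteq> opt ?X A"
      by (simp add: norm_opt_def del: nfd.simps gamb.simps)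
    then show "X \<in> opt ?X A" using U(2) by simp
  qed
qed

text \<open>A decision inducing \<open>G\<close> can be assembled from any parts that match
  \<open>G\<close> on their own arcs. The part on \<open>E\<close> may thus be chosen to induce
  \<open>X\<close>; backward induction keeps the assembled decision only if that part is optimal
  below \<open>E\<close>.\<close>

lemma optimal_at_Chance_child:
  assumes T: "decision_tree (Chance Ets)" "consistent A (Chance Ets)"
    and E: "(E, t) \<in> set Ets" and G: "G \<in> opt (gamb (Chance Ets)) A"
    and X: "X \<in> gamb t" "\<forall>w \<in> E. G w = X w"
  shows "X \<in> opt (gamb t) (A \<inter> E)"
proof -
  let ?X = "gamb (Chance Ets)"
  have "G \<in> ?X" using G choice_functionD(2)[OF opt gamb_consistent[OF T]] by blast
  then have G_arc: "\<exists>Y \<in> gamb s. \<forall>w \<in> F. G w = Y w" if "(F, s) \<in> set Ets" for F s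
    using that unfolding gamb_Chance_iff[OF T(1)] by blast
  \<comment> \<open>The last conjunct prescribes the gamble on the arc in question; any matching
    gamble serves elsewhere.\<close>
  have "\<exists>V \<in> nfd (snd p). \<exists>Y. gamb V = {Y} \<and> (\<forall>w \<in> fst p. G w = Y w) \<and> (p = (E, t) \<longrightarrow> Y = X)"
    if p: "p \<in> set Ets" for p
  proof (cases "p = (E, t)")
    case True
    then show ?thesis using ex_nfd[OF X(1)] X(2) by auto
  next
    case False
    from G_arc[of "fst p" "snd p"] p obtain Y where Y: "Y \<in> gamb (snd p)" "\<forall>w \<in> fst p. G w = Y w"
      by auto
    then show ?thesis using ex_nfd[OF Y(1)] False by auto
  qed
  then have "\<forall>p \<in> set Ets. \<exists>V. V \<in> nfd (snd p) \<and>
      (\<exists>Y. gamb V = {Y} \<and> (\<forall>w \<in> fst p. G w = Y w) \<and> (p = (E, t) \<longrightarrow> Y = X))"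
    by blast
  from bchoice[OF this] obtain v where v: "\<forall>p \<in> set Ets. v p \<in> nfd (snd p) \<and>
      (\<exists>Y. gamb (v p) = {Y} \<and> (\<forall>w \<in> fst p. G w = Y w) \<and> (p = (E, t) \<longrightarrow> Y = X))" ..
  let ?Us = "map (\<lambda>p. (fst p, v p)) Ets"
  \<comment> \<open>Stated for arbitrary \<open>f\<close>: with \<open>nfd\<close> it shows that the
    parts form a decision, with \<open>norm_opt\<close> it extracts optimality of a part.\<close>
  have sel: "?Us \<in> selections (map (\<lambda>(E, t). (E, f E t)) Ets) \<longleftrightarrow>
      (\<forall>p \<in> set Ets. v p \<in> f (fst p) (snd p))" for f
    by (simp add: selections_def list_all2_map1 list_all2_map2 list_all2_same rel_prod_sel
        case_prod_unfold)
  have U_nfd: "Chance ?Us \<in> nfd (Chance Ets)"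
    unfolding nfd.simps using v sel[of "\<lambda>_. nfd"] by blast
  obtain K where K: "gamb (Chance ?Us) = {K}" using gamb_of_nfd[OF U_nfd] by blast
  have "G \<in> gamb (Chance ?Us)"
  proof (subst gamb_Chance_iff[OF decision_tree_nfd[OF T(1) U_nfd]], clarsimp)
    fix F s assume "(F, s) \<in> set Ets"
    then show "\<exists>Y \<in> gamb (v (F, s)). \<forall>w \<in> F. G w = Y w" using v by fastforce
  qed
  then have "Chance ?Us \<in> norm_opt opt A (Chance Ets)"
    using G K U_nfd by (simp add: norm_opt_def del: nfd.simps gamb.simps)
  also have "norm_opt opt A (Chance Ets) =
    {U \<in> Chance ` selections (map (\<lambda>(E, t). (E, norm_opt opt (A \<inter> E) t)) Ets).
       gamb U \<subseteq> opt (oplus_sets (map (\<lambda>(E, t). (E, opt (gamb t) (A \<inter> E))) Ets)) A}"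
    unfolding back_norm[OF T, symmetric]
    by (rule back_Chance[OF opt T], rule back_norm) (use T in auto)
  finally have "?Us \<in> selections (map (\<lambda>(E, t). (E, norm_opt opt (A \<inter> E) t)) Ets)"
    by blast
  then have "v (E, t) \<in> norm_opt opt (A \<inter> E) t"
    using sel[of "\<lambda>E. norm_opt opt (A \<inter> E)"] E by auto
  moreover have "gamb (v (E, t)) = {X}" using v E by auto
  ultimately show ?thesis by (simp add: norm_opt_def)
qed

end

text \<open>This tree realises the setting of the conditioning and mixture properties. Consistency
  of the two sets makes \<open>A\<close> and its complement meet \<open>B\<close>, so they form a
  partition with non-empty blocks.\<close>

lemma ex_two_arc_Chance:
  fixes \<X> \<Z> :: "('w::finite, 'r) gamble set"
  assumes "gambles_consistent (A \<inter> B) \<X>" "gambles_consistent (- A \<inter> B) \<Z>"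
  obtains s t where "decision_tree (Chance [(A, s), (- A, t)])"
    "consistent B (Chance [(A, s), (- A, t)])" "gamb s = \<X>"
    "gamb (Chance [(A, s), (- A, t)]) = oplus_sets [(A, \<X>), (- A, \<Z>)]"
proof -
  obtain s where s: "decision_tree s" "consistent (A \<inter> B) s" "gamb s = \<X>"
    using ex_tree[OF assms(1)] by blast
  obtain t where t: "decision_tree t" "consistent (- A \<inter> B) t" "gamb t = \<Z>"
    using ex_tree[OF assms(2)] by blast
  have ne: "A \<inter> B \<noteq> {}" "- A \<inter> B \<noteq> {}" using assms by (auto simp: gambles_consistent_def)
  then have "partition_on UNIV {A, - A}"
    by (auto simp: partition_on_def disjoint_def)
  then have tree: "decision_tree (Chance [(A, s), (- A, t)])" using s t ne by auto
  have cons: "consistent B (Chance [(A, s), (- A, t)])"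
    using s t ne by (auto simp: Int_commute)
  show ?thesis by (rule that[OF tree cons s(3)]) (simp add: s(3) t(3))
qed

section \<open>Both directions of the equivalence, with each property read off from a small
  tree\<close>

theorem theorem25:
  fixes opt :: "('w::finite, 'r) choice"
  assumes "choice_function opt"
  shows "(\<forall>A T. decision_tree T \<and> consistent A T \<longrightarrow> back_opt opt A T = norm_opt opt A T) \<longleftrightarrow>
    backward_conditioning opt \<and> insensitive_omission opt \<and>
    preserves_nonoptimality opt \<and> backward_mixture opt"
proof
  assume props: "backward_conditioning opt \<and> insensitive_omission opt \<and>
    preserves_nonoptimality opt \<and> backward_mixture opt"
  show "\<forall>A T. decision_tree T \<and> consistent A T \<longrightarrow> back_opt opt A T = norm_opt opt A T"
    by (intro allI impI, elim conjE, rule back_opt_eq_norm_opt[OF assms]) (simp_all add: props)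
next
  assume back_norm:
    "\<forall>A T. decision_tree T \<and> consistent A T \<longrightarrow> back_opt opt A T = norm_opt opt A T"
  note at_Decision = optimal_at_Decision_child[OF assms back_norm]
    and at_Chance = optimal_at_Chance_child[OF assms back_norm]
    and optimal_Decision = optimal_Decision[OF assms back_norm]
  have alpha: "X \<in> opt \<Y> A"
    if \<X>: "gambles_consistent A \<X>" and \<Y>: "gambles_consistent A \<Y>" and sub: "\<Y> \<subseteq> \<X>"
      and X: "X \<in> opt \<X> A" "X \<in> \<Y>" for A \<X> \<Y> X
  proof -
    obtain s where s: "decision_tree s" "consistent A s" "gamb s = \<X>"
      using ex_tree[OF \<X>] by blast
    obtain t where t: "decision_tree t" "consistent A t" "gamb t = \<Y>"
      using ex_tree[OF \<Y>] by blast
    \<comment> \<open>Since \<open>\<Y> \<subseteq> \<X>\<close>, adding the child for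
      \<open>\<Y>\<close> leaves the gambles of the node equal to \<open>\<X>\<close>, while
      \<open>\<Y>\<close> becomes a submenu at a child.\<close>
    let ?lts = "[(0, s), (1, t)]"
    have T: "decision_tree (Decision ?lts)" "consistent A (Decision ?lts)"
      using s t \<X> by (auto simp: gambles_consistent_def)
    have "gamb (Decision ?lts) = \<X>" using s(3) t(3) sub by auto
    then show ?thesis using at_Decision[OF T, of 1 t X] t(3) X by simp
  qed
  have "preserves_nonoptimality opt"
    unfolding preserves_nonoptimality_def
  proof (intro allI impI subsetI, elim conjE IntE)
    fix A \<X> \<Y> X
    assume "gambles_consistent A \<X>" "gambles_consistent A \<Y>" "\<Y> \<subseteq> \<X>" "X \<in> opt \<X> A" "X \<in> \<Y>"
    then show "X \<in> opt \<Y> A" by (rule alpha)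
  qed
  moreover have "insensitive_omission opt"
    unfolding insensitive_omission_def
  proof (intro allI impI)
    fix A \<X> \<Y>
    assume asm: "gambles_consistent A \<X> \<and> gambles_consistent A \<Y> \<and> opt \<X> A \<subseteq> \<Y> \<and> \<Y> \<subseteq> \<X>"
    obtain s where s: "decision_tree s" "consistent A s" "gamb s = \<X>"
      using ex_tree[of A \<X>] asm by blast
    obtain t where t: "decision_tree t" "consistent A t" "gamb t = \<Y>"
      using ex_tree[of A \<Y>] asm by blast
    let ?lts = "[(0, s), (1, t)]"
    have A: "A \<noteq> {}" using asm by (simp add: gambles_consistent_def)
    have T: "decision_tree (Decision ?lts)" "consistent A (Decision ?lts)"
      "decision_tree (Decision [(0, t)])" "consistent A (Decision [(0, t)])"
      using s t A by auto
    have gamb: "gamb (Decision ?lts) = \<X>" "gamb (Decision [(0, t)]) = \<Y>"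
      using s(3) t(3) asm by auto
    have union: "(\<Union>(l, t) \<in> set ?lts. opt (gamb t) A) = opt \<X> A \<union> opt \<Y> A"
      "(\<Union>(l, t) \<in> set [(0, t)]. opt (gamb t) A) = opt \<Y> A"
      using s(3) t(3) by simp_all
    \<comment> \<open>Path independence at the two-arc node. Next, \<open>alpha\<close> absorbs the
      first set into the second, and path independence at the one-arc node gives idempotence of
      \<open>opt\<close> on \<open>\<Y>\<close>.\<close>
    have "opt \<X> A = opt (opt \<X> A \<union> opt \<Y> A) A"
      using optimal_Decision[OF T(1,2)] unfolding gamb union .
    also have "opt \<X> A \<union> opt \<Y> A = opt \<Y> A"
    proof (rule Un_absorb1, rule subsetI)
      fix X assume X: "X \<in> opt \<X> A"
      show "X \<in> opt \<Y> A" by (rule alpha[of A \<X>]) (use asm X in auto)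
    qed
    also have "opt (opt \<Y> A) A = opt \<Y> A"
      using optimal_Decision[OF T(3,4)] unfolding gamb union by (rule sym)
    finally show "opt \<Y> A = opt \<X> A" by (rule sym)
  qed
  moreover have "backward_conditioning opt"
    unfolding backward_conditioning_def
  proof (intro allI impI, elim conjE exE bexE)
    fix A B \<X> X Y \<Z> Z
    assume \<X>: "gambles_consistent (A \<inter> B) \<X>" and XY: "{X, Y} \<subseteq> \<X>" "\<forall>w \<in> A. X w = Y w"
      and \<Z>: "gambles_consistent (- A \<inter> B) \<Z>"
      and G: "oplus [(A, X), (- A, Z)] \<in> opt (oplus_sets [(A, \<X>), (- A, \<Z>)]) B"
    obtain s t where T: "decision_tree (Chance [(A, s), (- A, t)])"
      "consistent B (Chance [(A, s), (- A, t)])" and s: "gamb s = \<X>"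
      and gamb: "gamb (Chance [(A, s), (- A, t)]) = oplus_sets [(A, \<X>), (- A, \<Z>)]"
      using ex_two_arc_Chance[OF \<X> \<Z>] .
    \<comment> \<open>The optimal combination agrees with \<open>X\<close>, hence with
      \<open>Y\<close>, on \<open>A\<close>, so \<open>Y\<close> can be prescribed as the gamble on
      that arc.\<close>
    have "Y \<in> opt (gamb s) (B \<inter> A)"
      by (rule at_Chance[OF T _ G[folded gamb]]) (use XY s in auto)
    then show "Y \<in> opt \<X> (A \<inter> B)" by (simp only: s Int_commute)
  qed
  moreover have "backward_mixture opt"
    unfolding backward_mixture_def
  proof (intro allI impI subsetI, elim conjE)
    fix A B Z \<X> G
    assume Z: "gambles_consistent (- A \<inter> B) {Z}" and \<X>: "gambles_consistent (A \<inter> B) \<X>"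
      and G: "G \<in> opt (oplus_sets [(A, \<X>), (- A, {Z})]) B"
    obtain s t where T: "decision_tree (Chance [(A, s), (- A, t)])"
      "consistent B (Chance [(A, s), (- A, t)])" and s: "gamb s = \<X>"
      and gamb: "gamb (Chance [(A, s), (- A, t)]) = oplus_sets [(A, \<X>), (- A, {Z})]"
      using ex_two_arc_Chance[OF \<X> Z] .
    have "G \<in> oplus_sets [(A, \<X>), (- A, {Z})]"
      using G choice_functionD(2)[OF assms gamb_consistent[OF T]] unfolding gamb by blast
    then obtain X where X: "X \<in> \<X>" "G = oplus [(A, X), (- A, Z)]"
      unfolding oplus_sets_two by blast
    \<comment> \<open>The component of \<open>G\<close> on \<open>A\<close> is the required optimal
      witness for the mixture.\<close>
    have "X \<in> opt (gamb s) (B \<inter> A)"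
      by (rule at_Chance[OF T _ G[folded gamb]]) (use X s in auto)
    then have "X \<in> opt \<X> (A \<inter> B)" by (simp only: s Int_commute)
    then show "G \<in> oplus_sets [(A, opt \<X> (A \<inter> B)), (- A, {Z})]"
      unfolding oplus_sets_two using X(2) by blast
  qed
  ultimately show "backward_conditioning opt \<and> insensitive_omission opt \<and>
      preserves_nonoptimality opt \<and> backward_mixture opt"
    by blast
qed

end
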